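(* For $1<p\le\infty$, the convex-set valued maximal operator $M:L^p_{\mathcal{K}}(\mathbb{R}^n,|\cdot|)\to L^p_{\mathcal{K}}(\mathbb{R}^n,|\cdot|)$ is bounded; that is, there is a constant $C$ such that $\|MF\|_{L^p_{\mathcal{K}}(\mathbb{R}^n,|\cdot|)}\le C\|F\|_{L^p_{\mathcal{K}}(\mathbb{R}^n,|\cdot|)}$ for all $F\in L^p_{\mathcal{K}}(\mathbb{R}^n,|\cdot|)$. When $p=1$, $M:L^1_{\mathcal{K}}(\mathbb{R}^n,|\cdot|)\to L^{1,\infty}_{\mathcal{K}}(\mathbb{R}^n,|\cdot|)$ is bounded; that is, there is a constant $C$ such that for all $\lambda>0$ and $F\in L^1_{\mathcal{K}}(\mathbb{R}^n,|\cdot|)$, $$m_n(\{x\in\mathbb{R}^n:|MF(x)|>\lambda\})\le\frac{C}{\lambda}\int_{\mathbb{R}^n}|F(x)|\,dx .$$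
   Context: $m_n$ is Lebesgue measure on $\mathbb{R}^n$. $\mathcal{K}_{bcs}(\mathbb{R}^d)$ is the collection of nonempty closed, bounded, convex, symmetric ($-K=K$) subsets of $\mathbb{R}^d$. $F:\mathbb{R}^n\to\mathcal{K}_{bcs}(\mathbb{R}^d)$ is measurable if $\{x:F(x)\cap U\ne\emptyset\}$ is measurable for each open $U\subset\mathbb{R}^d$. For $K\subset\mathbb{R}^d$, $|K|=\sup\{|v|:v\in K\}$ with $|v|$ the Euclidean norm. $L^p_{\mathcal{K}}(\mathbb{R}^n,|\cdot|)$ is the set of measurable $F:\mathbb{R}^n\to\mathcal{K}_{bcs}(\mathbb{R}^d)$ with $\|F\|=\big(\int|F(x)|^p dx\big)^{1/p}<\infty$ (ess sup if $p=\infty$); functions are identified when equal a.e., so values need lie in $\mathcal{K}_{bcs}(\mathbb{R}^d)$ only a.e. Every such $F$ is locally integrably bounded ($F(x)\subset k(x)\mathbf{B}$ a.e. for some nonnegative $k\in L^1_{loc}(\mathbb{R}^n)$, $\mathbf{B}$ the open unit ball). The Aumann integral is $\int_QF\,dy=\{\int_Qf\,dy: f\in L^1(Q,\mathbb{R}^d),\ f(y)\in F(y)\text{ a.e.}\}$. For a cube $Q$ (sides parallel to the axes), $A_QF(x)=\frac{1}{m_n(Q)}\int_QF(y)\,dy$ if $x\in Q$ and $A_QF(x)=\{0\}$ otherwise. The maximal operator is $MF(x)=\overline{\mathrm{conv}}\big(\bigcup_QA_QF(x)\big)$, the closed convex hull of the union over all cubes $Q$. *)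

theory Defs
  imports "HOL-Analysis.Analysis" "HOL-Probability.Essential_Supremum"
begin

section \<open>Convex bodies and measurable set-valued functions\<close>

definition bcs_sets :: "'b::euclidean_space set set" where
  "bcs_sets = {K. K \<noteq> {} \<and> closed K \<and> bounded K \<and> convex K \<and> uminus ` K = K}"

text \<open>The supremum is taken in the extended reals, since \<open>MF x\<close> may be unbounded on a null set.\<close>

definition set_norm :: "'b::euclidean_space set \<Rightarrow> ennreal" where
  "set_norm K = (SUP v\<in>K. ennreal (norm v))"

definition set_measurable :: "('a::euclidean_space \<Rightarrow> 'b::euclidean_space set) \<Rightarrow> bool" where
  "set_measurable F \<longleftrightarrow> (\<forall>U. open U \<longrightarrow> {x. F x \<inter> U \<noteq> {}} \<in> sets lebesgue)"


section \<open>Lebesgue spaces of convex-set valued functions\<close>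

text \<open>Used for exponents \<open>r > 0\<close> only.\<close>

definition ennpowr :: "ennreal \<Rightarrow> real \<Rightarrow> ennreal" where
  "ennpowr x r = (if x = \<infinity> then \<infinity> else ennreal (enn2real x powr r))"

definition LpK_norm :: "ennreal \<Rightarrow> ('a::euclidean_space \<Rightarrow> 'b::euclidean_space set) \<Rightarrow> ennreal" where
  "LpK_norm p F =
     (if p = \<infinity> then esssup lebesgue (\<lambda>x. set_norm (F x))
      else ennpowr (\<integral>\<^sup>+x. ennpowr (set_norm (F x)) (enn2real p) \<partial>lebesgue) (1 / enn2real p))"

text \<open>
  Elements are functions rather than classes modulo equality almost everywhere; accordingly
  the values are required to be convex bodies only almost everywhere.
\<close>

definition LpK :: "ennreal \<Rightarrow> ('a::euclidean_space \<Rightarrow> 'b::euclidean_space set) set" where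
  "LpK p = {F. set_measurable F \<and> (AE x in lebesgue. F x \<in> bcs_sets) \<and> LpK_norm p F < \<infinity>}"

definition weak_L1K_norm :: "('a::euclidean_space \<Rightarrow> 'b::euclidean_space set) \<Rightarrow> ennreal" where
  "weak_L1K_norm F =
     (SUP t\<in>{0<..}. ennreal t * emeasure lebesgue {x. set_norm (F x) > ennreal t})"

definition weak_L1K :: "('a::euclidean_space \<Rightarrow> 'b::euclidean_space set) set" where
  "weak_L1K = {F. set_measurable F \<and> (AE x in lebesgue. F x \<in> bcs_sets) \<and> weak_L1K_norm F < \<infinity>}"


section \<open>The Aumann integral and the maximal operator\<close>

definition aumann_integral ::
    "'a::euclidean_space set \<Rightarrow> ('a \<Rightarrow> 'b::euclidean_space set) \<Rightarrow> 'b set" where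
  "aumann_integral Q F =
     {set_lebesgue_integral lebesgue Q f | f.
        set_integrable lebesgue Q f \<and> (AE y in lebesgue. y \<in> Q \<longrightarrow> f y \<in> F y)}"

text \<open>
  Cubes are taken closed. If \<open>0 \<in> F x\<close> almost everywhere, which holds for all functions in
  \<open>LpK p\<close>, then open or half-open cubes give the same maximal function at every point: a
  selection on a cube extends by zero to a slightly larger one, and averages over the larger
  cubes converge to the average over the original cube.
\<close>

definition cubes :: "'a::euclidean_space set set" where
  "cubes = {cbox a (a + s *\<^sub>R One) | a s. s > 0}"

definition set_average ::
    "'a::euclidean_space set \<Rightarrow> ('a \<Rightarrow> 'b::euclidean_space set) \<Rightarrow> 'a \<Rightarrow> 'b set" where
  "set_average Q F x =
     (if x \<in> Q then (\<lambda>v. (1 / measure lebesgue Q) *\<^sub>R v) ` aumann_integral Q F else {0})"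

definition maximal_op ::
    "('a::euclidean_space \<Rightarrow> 'b::euclidean_space set) \<Rightarrow> 'a \<Rightarrow> 'b set" where
  "maximal_op F x = closure (convex hull (\<Union>Q\<in>cubes. set_average Q F x))"

end

theory Submission
  imports Defs
begin

text \<open>
  The norm of a selection's average over \<open>Q\<close> is at most the average of \<open>g = |F|\<close> over \<open>Q\<close>, and
  balls are closed and convex, so \<open>|MF|\<close> is dominated by the scalar maximal function of \<open>g\<close>.
  Covering \<open>{|MF| > t}\<close> by cubes and applying Vitali's lemma to the part of \<open>g\<close> above \<open>t/2\<close>
  bounds its measure by \<open>C/t\<close> times the integral of \<open>g\<close> over \<open>{g > t/2}\<close>, which is the weak type
  estimate and, after integration against \<open>p t\<^sup>p\<^sup>-\<^sup>1 dt\<close>, the strong one. Measurability of \<open>MF\<close> comes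
  for free: a point \<open>v\<close> of the convex hull at \<open>x\<close> can be shrunk to \<open>c v\<close> with \<open>c < 1\<close> arbitrarily
  close to 1, and then, by enlarging the cubes involved and extending the selections by zero, it
  lies in the hull at every point near \<open>x\<close>. So \<open>{x. MF x \<inter> U \<noteq> {}}\<close> is even open when \<open>U\<close> is.
\<close>


section \<open>Covering by cubes\<close>

text \<open>\<open>lebesgue\<close> is the completion of \<open>lborel\<close>, and Fubini in the
  interpolation argument needs it to be sigma-finite.\<close>

lemma sigma_finite_measure_completion:
  assumes "sigma_finite_measure M"
  shows "sigma_finite_measure (completion M)"
proof -
  obtain A where A: "countable A" "A \<subseteq> sets M" "\<Union>A = space M" "\<forall>a\<in>A. emeasure M a \<noteq> \<infinity>"
    using sigma_finite_measure.sigma_finite_countable[OF assms] by blast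
  show ?thesis
  proof
    show "\<exists>A. countable A \<and> A \<subseteq> sets (completion M) \<and> \<Union> A = space (completion M) \<and>
            (\<forall>a\<in>A. emeasure (completion M) a \<noteq> \<infinity>)"
      using A by (intro exI[of _ A]) (auto simp: subset_iff)
  qed
qed

text \<open>Countable subadditivity as an integral over \<open>count_space I\<close>, so that the
  centres picked by the covering lemma serve as indices without enumeration. The indicator of the
  union is at most the sum of the indicators.\<close>

lemma emeasure_UN_countable_le:
  assumes "countable I" and X [measurable]: "\<And>i. i \<in> I \<Longrightarrow> X i \<in> sets M"
  shows "emeasure M (\<Union>(X ` I)) \<le> (\<integral>\<^sup>+i. emeasure M (X i) \<partial>count_space I)"
proof -
  have "indicator (\<Union>(X ` I)) x \<le> (\<integral>\<^sup>+i. indicator (X i) x \<partial>count_space I)" for x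
  proof (cases "x \<in> \<Union>(X ` I)")
    case True
    then obtain j where j: "j \<in> I" "x \<in> X j" by auto
    have "(1::ennreal) = (\<integral>\<^sup>+i. indicator {j} i \<partial>count_space I)"
      using j by simp
    also have "\<dots> \<le> (\<integral>\<^sup>+i. indicator (X i) x \<partial>count_space I)"
      using j by (intro nn_integral_mono) (auto split: split_indicator)
    finally show ?thesis using True by simp
  qed simp
  moreover have "\<Union>(X ` I) \<in> sets M"
    using assms by auto
  ultimately have "emeasure M (\<Union>(X ` I)) \<le> (\<integral>\<^sup>+x. \<integral>\<^sup>+i. indicator (X i) x \<partial>count_space I \<partial>M)"
    unfolding nn_integral_indicator[OF \<open>\<Union>(X ` I) \<in> sets M\<close>, symmetric]
    by (intro nn_integral_mono) blast
  also have "\<dots> = (\<integral>\<^sup>+i. \<integral>\<^sup>+x. indicator (X i) x \<partial>M \<partial>count_space I)"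
    using assms by (intro nn_integral_count_space_nn_integral) auto
  also have "\<dots> = (\<integral>\<^sup>+i. emeasure M (X i) \<partial>count_space I)"
    by (intro nn_integral_cong) simp
  finally show ?thesis .
qed

section \<open>Cubes and the Vitali covering estimate\<close>

lemma emeasure_lebesgue_cube:
  fixes a :: "'a::euclidean_space"
  assumes "0 \<le> s"
  shows "emeasure lebesgue (cbox a (a + s *\<^sub>R One)) = ennreal (s ^ DIM('a))"
  using assms by (simp add: emeasure_lborel_cbox_eq inner_add_left)

lemma cubesE:
  fixes Q :: "'a::euclidean_space set"
  assumes "Q \<in> cubes"
  obtains a s where "0 < s" "Q = cbox a (a + s *\<^sub>R One)" "measure lebesgue Q = s ^ DIM('a)"
    "emeasure lebesgue Q = ennreal (s ^ DIM('a))" "Q \<in> sets lebesgue"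
proof -
  obtain a s where "0 < s" "Q = cbox a (a + s *\<^sub>R One)"
    using assms by (auto simp: cubes_def)
  moreover from this have "emeasure lebesgue Q = ennreal (s ^ DIM('a))"
    using emeasure_lebesgue_cube[of s a] by simp
  moreover from this have "measure lebesgue Q = s ^ DIM('a)"
    using \<open>0 < s\<close> by (simp add: measure_def)
  ultimately show thesis using that by simp
qed

text \<open>Two points of the cube differ by at most \<open>s\<close> in each coordinate, hence by
  at most the diagonal. Centring the ball at \<open>x\<close> lets the covering balls be indexed by
  the points they have to cover.\<close>

lemma cube_subset_cball:
  fixes a x :: "'a::euclidean_space"
  assumes "x \<in> cbox a (a + s *\<^sub>R One)" "0 < s"
  shows "cbox a (a + s *\<^sub>R One) \<subseteq> cball x (s * norm (One::'a))"
proof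
  fix y assume "y \<in> cbox a (a + s *\<^sub>R One)"
  with assms have "\<bar>(x - y) \<bullet> b\<bar> \<le> \<bar>(s *\<^sub>R One) \<bullet> b\<bar>" if "b \<in> Basis" for b
    using that by (force simp: mem_box inner_diff_left inner_add_left)
  then have "norm (x - y) \<le> norm (s *\<^sub>R (One::'a))"
    by (rule norm_le_componentwise)
  then show "y \<in> cball x (s * norm (One::'a))"
    using assms by (simp add: dist_norm)
qed

text \<open>
  The ratio of the volume of a ball with five times the radius in \<open>cube_subset_cball\<close> to that of
  the cube.
\<close>

definition vitali_const :: "'a::euclidean_space itself \<Rightarrow> real" where
  "vitali_const _ = unit_ball_vol DIM('a) * (5 * norm (One::'a)) ^ DIM('a)"

lemma vitali_const_pos: "0 < vitali_const TYPE('a::euclidean_space)"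
  unfolding vitali_const_def by (intro mult_pos_pos zero_less_power) simp_all

text \<open>The Hardy-Littlewood covering argument: among balls around the chosen cubes, Vitali's
  lemma selects disjoint ones whose fivefold dilates cover \<open>E\<close>. The cubes inside them
  are disjoint, so the integrals of \<open>h\<close> over these add up to at most the full
  integral.\<close>

lemma weak_type_cubes:
  fixes h :: "'a::euclidean_space \<Rightarrow> ennreal"
  assumes h [measurable]: "h \<in> borel_measurable lebesgue" and t: "0 < t"
    and E: "\<And>x. x \<in> E \<Longrightarrow>
      \<exists>Q\<in>cubes. x \<in> Q \<and> ennreal t * emeasure lebesgue Q < (\<integral>\<^sup>+y\<in>Q. h y \<partial>lebesgue)"
  shows "emeasure lebesgue E \<le> ennreal (vitali_const TYPE('a) / t) * (\<integral>\<^sup>+y. h y \<partial>lebesgue)"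
proof (cases "(\<integral>\<^sup>+y. h y \<partial>lebesgue) = \<infinity>")
  case True
  then show ?thesis using t vitali_const_pos[where ?'a='a]
    by (simp add: ennreal_mult_top)
next
  case False
  define I where "I = (\<integral>\<^sup>+y. h y \<partial>lebesgue)"
  let ?n = "DIM('a)"
  let ?Q = "\<lambda>a s. cbox a (a + s *\<^sub>R One) :: 'a set"
  have "\<forall>x\<in>E. \<exists>a s. 0 < s \<and> x \<in> ?Q a s \<and> ennreal (t * s ^ ?n) < (\<integral>\<^sup>+y\<in>?Q a s. h y \<partial>lebesgue)"
  proof
    fix x assume "x \<in> E"
    then obtain Q where Q: "Q \<in> cubes" "x \<in> Q"
      "ennreal t * emeasure lebesgue Q < (\<integral>\<^sup>+y\<in>Q. h y \<partial>lebesgue)"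
      using E by blast
    from Q(1) obtain a s where "0 < s" "Q = ?Q a s" "emeasure lebesgue Q = ennreal (s ^ ?n)"
      by (rule cubesE)
    then show "\<exists>a s. 0 < s \<and> x \<in> ?Q a s \<and> ennreal (t * s ^ ?n) < (\<integral>\<^sup>+y\<in>?Q a s. h y \<partial>lebesgue)"
      using Q t by (intro exI[of _ a] exI[of _ s]) (auto simp: ennreal_mult simp del: emeasure_completion)
  qed
  then obtain a where
    "\<forall>x\<in>E. \<exists>s. 0 < s \<and> x \<in> ?Q (a x) s \<and> ennreal (t * s ^ ?n) < (\<integral>\<^sup>+y\<in>?Q (a x) s. h y \<partial>lebesgue)"
    by (rule bchoice[THEN exE])
  then obtain s where as:
    "\<forall>x\<in>E. 0 < s x \<and> x \<in> ?Q (a x) (s x) \<and>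
      ennreal (t * s x ^ ?n) < (\<integral>\<^sup>+y\<in>?Q (a x) (s x). h y \<partial>lebesgue)"
    by (rule bchoice[THEN exE])
  then have s: "\<And>x. x \<in> E \<Longrightarrow> 0 < s x" and xQ: "\<And>x. x \<in> E \<Longrightarrow> x \<in> ?Q (a x) (s x)"
    and Q: "\<And>x. x \<in> E \<Longrightarrow> ennreal (t * s x ^ ?n) < (\<integral>\<^sup>+y\<in>?Q (a x) (s x). h y \<partial>lebesgue)"
    by blast+
  have QI: "(\<integral>\<^sup>+y\<in>A. h y \<partial>lebesgue) \<le> I" for A
    unfolding I_def by (intro nn_integral_mono) (auto split: split_indicator)
  obtain J where J: "I = ennreal J" "0 \<le> J"
    using False by (cases I) (auto simp: I_def)
  define r where "r = (\<lambda>x. s x * norm (One::'a))"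
  \<comment> \<open>Vitali's lemma asks for bounded radii. The volume of each cube is at most
    \<open>J / t\<close>, and a side longer than 1 is at most the volume.\<close>
  have s_le: "s x \<le> max 1 (J / t)" if "x \<in> E" for x
  proof -
    have "ennreal (t * s x ^ ?n) < ennreal J"
      using Q[OF that] QI J by (metis less_le_trans)
    then have *: "s x ^ ?n \<le> J / t"
      using t J by (simp add: field_simps ennreal_less_iff s[OF that] less_imp_le)
    show ?thesis
    proof (cases "s x \<le> 1")
      case False
      then have "s x \<le> s x ^ ?n" by (intro self_le_power) auto
      with * show ?thesis by simp
    qed simp
  qed
  have r: "0 < r x \<and> r x \<le> max 1 (J / t) * norm (One::'a)" if "x \<in> E" for x
    using s[OF that] s_le[OF that] unfolding r_def
    by (intro conjI mult_pos_pos mult_right_mono) auto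
  have cover: "E \<subseteq> (\<Union>x\<in>E. cball x (r x))"
    using r by (force intro: less_imp_le)
  obtain C where C: "countable C" "C \<subseteq> E"
      "pairwise (\<lambda>i j. disjnt (cball i (r i)) (cball j (r j))) C"
      "E \<subseteq> (\<Union>i\<in>C. cball i (5 * r i))"
    using Vitali_covering_lemma_cballs[where S=E and K=E and a="\<lambda>x. x" and r=r, OF cover r] by blast
  let ?X = "\<lambda>x. ?Q (a x) (s x)"
  have Xsub: "?X x \<subseteq> cball x (r x)" if "x \<in> C" for x
    unfolding r_def using that C(2) xQ s by (intro cube_subset_cball) auto
  have disj: "disjoint_family_on ?X C"
    unfolding disjoint_family_on_def
  proof (intro ballI impI)
    fix i j assume "i \<in> C" "j \<in> C" "i \<noteq> j"
    then have "disjnt (cball i (r i)) (cball j (r j))"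
      using C(3) by (auto simp: pairwise_def)
    then show "?X i \<inter> ?X j = {}"
      using Xsub \<open>i \<in> C\<close> \<open>j \<in> C\<close> unfolding disjnt_def by blast
  qed
  have ball: "emeasure lebesgue (cball x (5 * r x)) \<le>
      ennreal (vitali_const TYPE('a) / t) * (\<integral>\<^sup>+y\<in>?X x. h y \<partial>lebesgue)" if "x \<in> C" for x
  proof -
    have x: "x \<in> E" using that C by auto
    have "emeasure lebesgue (cball x (5 * r x)) = ennreal (unit_ball_vol ?n * (5 * r x) ^ ?n)"
      using r[OF x] by (simp add: emeasure_cball)
    also have "unit_ball_vol ?n * (5 * r x) ^ ?n = (vitali_const TYPE('a) / t) * (t * s x ^ ?n)"
      using t by (simp add: vitali_const_def r_def power_mult_distrib)
    also have "ennreal \<dots> = ennreal (vitali_const TYPE('a) / t) * ennreal (t * s x ^ ?n)"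
      using t s[OF x] vitali_const_pos[where ?'a='a] by (intro ennreal_mult) auto
    also have "\<dots> \<le> ennreal (vitali_const TYPE('a) / t) * (\<integral>\<^sup>+y\<in>?X x. h y \<partial>lebesgue)"
      using Q[OF x] by (intro mult_left_mono) auto
    finally show ?thesis .
  qed
  have "emeasure lebesgue E \<le> emeasure lebesgue (\<Union>i\<in>C. cball i (5 * r i))"
    using C by (intro emeasure_mono) auto
  also have "\<dots> \<le> (\<integral>\<^sup>+i. emeasure lebesgue (cball i (5 * r i)) \<partial>count_space C)"
    by (rule emeasure_UN_countable_le) (use C in auto)
  also have "\<dots> \<le> (\<integral>\<^sup>+i. ennreal (vitali_const TYPE('a) / t) * (\<integral>\<^sup>+y\<in>?X i. h y \<partial>lebesgue) \<partial>count_space C)"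
    by (rule nn_integral_mono) (use ball in \<open>simp del: emeasure_completion\<close>)
  also have "\<dots> = ennreal (vitali_const TYPE('a) / t) * (\<integral>\<^sup>+i. (\<integral>\<^sup>+y\<in>?X i. h y \<partial>lebesgue) \<partial>count_space C)"
    by (rule nn_integral_cmult) simp
  \<comment> \<open>Read as values of the measure with density \<open>h\<close>, the integrals over
    the disjoint cubes sum up by countable additivity.\<close>
  also have "(\<integral>\<^sup>+i. (\<integral>\<^sup>+y\<in>?X i. h y \<partial>lebesgue) \<partial>count_space C) =
      (\<integral>\<^sup>+i. emeasure (density lebesgue h) (?X i) \<partial>count_space C)"
    by (intro nn_integral_cong) (simp add: emeasure_density)
  also have "\<dots> = emeasure (density lebesgue h) (\<Union>(?X ` C))"
    by (rule emeasure_UN_countable[symmetric]) (use C disj in auto)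
  also have "\<dots> \<le> emeasure (density lebesgue h) UNIV"
    by (intro emeasure_mono) auto
  also have "\<dots> = (\<integral>\<^sup>+y. h y \<partial>lebesgue)"
    by (subst emeasure_density) auto
  finally show ?thesis
    by (simp add: mult_left_mono)
qed



section \<open>Set-valued averages\<close>

text \<open>A supremum exceeds \<open>t\<close> only if one of its members does. This turns
  superlevel sets of |F| into sets where \<open>F\<close> meets an open set, the form in which
  \<open>set_measurable\<close> is stated.\<close>

lemma less_set_norm_iff:
  assumes "0 \<le> t"
  shows "ennreal t < set_norm K \<longleftrightarrow> K \<inter> {v. t < norm v} \<noteq> {}"
  using assms by (auto simp: set_norm_def less_SUP_iff ennreal_less_iff)

lemma borel_measurable_set_norm:
  assumes "set_measurable F"
  shows "(\<lambda>x. set_norm (F x)) \<in> borel_measurable lebesgue"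
proof (rule borel_measurableI_greater)
  fix y :: ennreal
  show "{x \<in> space lebesgue. y < set_norm (F x)} \<in> sets lebesgue"
  proof (cases y)
    case (real t)
    have "open {v::'b. t < norm v}"
      by (intro open_Collect_less continuous_intros)
    with assms real show ?thesis
      by (auto simp: less_set_norm_iff set_measurable_def)
  qed simp
qed

section \<open>Symmetric convex bodies and Aumann integrals\<close>

lemma bcs_sets_uminus: "K \<in> bcs_sets \<Longrightarrow> v \<in> K \<Longrightarrow> - v \<in> K"
  by (auto simp: bcs_sets_def)

text \<open>0 is the midpoint of \<open>v\<close> and \<open>- v\<close>. It is an admissible value
  of selections, so that they extend by zero.\<close>

lemma zero_mem_bcs_sets:
  assumes "K \<in> bcs_sets"
  shows "0 \<in> K"
proof -
  obtain v where v: "v \<in> K" using assms by (auto simp: bcs_sets_def)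
  have "(1/2) *\<^sub>R v + (1/2) *\<^sub>R (- v) \<in> K"
    using assms v bcs_sets_uminus[OF assms v] by (intro convexD) (auto simp: bcs_sets_def)
  then show ?thesis by simp
qed

lemma AE_zero_mem:
  "AE x in lebesgue. F x \<in> bcs_sets \<Longrightarrow> AE x in lebesgue. 0 \<in> F x"
  by (auto intro: zero_mem_bcs_sets)

lemma zero_mem_aumann_integral:
  assumes "AE y in lebesgue. 0 \<in> F y"
  shows "0 \<in> aumann_integral Q F"
  unfolding aumann_integral_def using assms
  by (auto intro!: exI[of _ "\<lambda>_. 0"] simp: set_integrable_def set_lebesgue_integral_def)

text \<open>Extended by zero, a selection on \<open>Q\<close> becomes one on \<open>R\<close> with
  the same integral.\<close>

lemma aumann_integral_subset:
  assumes "AE y in lebesgue. 0 \<in> F y" and "Q \<subseteq> R"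
  shows "aumann_integral Q F \<subseteq> aumann_integral R F"
proof
  fix v assume "v \<in> aumann_integral Q F"
  then obtain f where f: "v = set_lebesgue_integral lebesgue Q f" "set_integrable lebesgue Q f"
    "AE y in lebesgue. y \<in> Q \<longrightarrow> f y \<in> F y"
    by (auto simp: aumann_integral_def)
  define g where "g = (\<lambda>y. indicator Q y *\<^sub>R f y)"
  have g: "indicator R y *\<^sub>R g y = indicator Q y *\<^sub>R f y" for y
    using assms(2) by (auto simp: g_def split: split_indicator)
  have "AE y in lebesgue. y \<in> R \<longrightarrow> g y \<in> F y"
    using f(3) assms(1) by eventually_elim (auto simp: g_def split: split_indicator)
  with f show "v \<in> aumann_integral R F"
    unfolding aumann_integral_def
    by (auto intro!: exI[of _ g] simp: set_integrable_def set_lebesgue_integral_def g)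
qed

lemma uminus_mem_aumann_integral:
  assumes "AE y in lebesgue. F y \<in> bcs_sets" and "v \<in> aumann_integral Q F"
  shows "- v \<in> aumann_integral Q F"
proof -
  obtain f where f: "v = set_lebesgue_integral lebesgue Q f" "set_integrable lebesgue Q f"
    "AE y in lebesgue. y \<in> Q \<longrightarrow> f y \<in> F y"
    using assms by (auto simp: aumann_integral_def)
  have "AE y in lebesgue. y \<in> Q \<longrightarrow> - f y \<in> F y"
    using f(3) assms(1) by eventually_elim (auto intro: bcs_sets_uminus)
  with f show ?thesis
    unfolding aumann_integral_def
    by (auto intro!: exI[of _ "\<lambda>y. - f y"] simp: set_integrable_def set_lebesgue_integral_def)
qed

lemma norm_aumann_integral_le:
  assumes "v \<in> aumann_integral Q F"
  shows "ennreal (norm v) \<le> (\<integral>\<^sup>+y\<in>Q. set_norm (F y) \<partial>lebesgue)"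
proof -
  obtain f where f: "v = set_lebesgue_integral lebesgue Q f" "set_integrable lebesgue Q f"
    "AE y in lebesgue. y \<in> Q \<longrightarrow> f y \<in> F y"
    using assms by (auto simp: aumann_integral_def)
  have "ennreal (norm v) \<le> (\<integral>\<^sup>+y. norm (indicator Q y *\<^sub>R f y) \<partial>lebesgue)"
    using f(2) unfolding f(1) set_lebesgue_integral_def set_integrable_def
    by (rule integral_norm_bound_ennreal)
  also have "\<dots> \<le> (\<integral>\<^sup>+y\<in>Q. set_norm (F y) \<partial>lebesgue)"
  proof (rule nn_integral_mono_AE)
    show "AE y in lebesgue. ennreal (norm (indicator Q y *\<^sub>R f y)) \<le> set_norm (F y) * indicator Q y"
      using f(3) by eventually_elim (auto simp: set_norm_def intro: SUP_upper split: split_indicator)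
  qed
  finally show ?thesis .
qed

section \<open>The averages at a point and their stability under small moves of the point\<close>

definition cube_averages ::
    "('a::euclidean_space \<Rightarrow> 'b::euclidean_space set) \<Rightarrow> 'a \<Rightarrow> 'b set" where
  "cube_averages F x = (\<Union>Q\<in>cubes. set_average Q F x)"

lemma maximal_op_eq: "maximal_op F x = closure (convex hull cube_averages F x)"
  by (simp add: maximal_op_def cube_averages_def)

text \<open>The first case covers the cubes that miss \<open>x\<close>, whose average is
  \<open>{0}\<close> by convention.\<close>

lemma cube_averages_cases:
  assumes "v \<in> cube_averages F x"
  obtains "v = 0"
  | Q w where "Q \<in> cubes" "x \<in> Q" "w \<in> aumann_integral Q F" "v = (1 / measure lebesgue Q) *\<^sub>R w"
  using assms by (force simp: cube_averages_def set_average_def split: if_splits)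

lemma cube_averages_intro:
  assumes "Q \<in> cubes" "x \<in> Q" "w \<in> aumann_integral Q F"
  shows "(1 / measure lebesgue Q) *\<^sub>R w \<in> cube_averages F x"
  using assms by (force simp: cube_averages_def set_average_def)

lemma zero_mem_cube_averages:
  fixes F :: "'a::euclidean_space \<Rightarrow> 'b::euclidean_space set"
  assumes "AE y in lebesgue. 0 \<in> F y"
  shows "0 \<in> cube_averages F x"
proof -
  \<comment> \<open>Any cube will do: its average contains 0 whether or not it contains
    \<open>x\<close>.\<close>
  have "cbox 0 (0 + 1 *\<^sub>R One) \<in> (cubes :: 'a set set)"
    unfolding cubes_def using zero_less_one by blast
  moreover have "0 \<in> set_average Q F x" for Q
    using zero_mem_aumann_integral[OF assms, of Q] by (force simp: set_average_def)
  ultimately show ?thesis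
    unfolding cube_averages_def by blast
qed

text \<open>
  A cube containing \<open>x\<close> is enlarged, at the price of the factor \<open>c\<close> in the average, to a cube
  containing \<open>x\<close> in its interior.
\<close>

lemma eventually_cube_averages:
  fixes F :: "'a::euclidean_space \<Rightarrow> 'b::euclidean_space set"
  assumes F: "AE y in lebesgue. 0 \<in> F y" and v: "v \<in> cube_averages F x"
    and c: "0 < c" "c < 1"
  shows "eventually (\<lambda>x'. c *\<^sub>R v \<in> cube_averages F x') (nhds x)"
  using v
proof (cases rule: cube_averages_cases)
  case 1
  then show ?thesis using zero_mem_cube_averages[OF F] by simp
next
  case (2 Q w)
  let ?n = "DIM('a)"
  obtain a s where s: "0 < s" and Q: "Q = cbox a (a + s *\<^sub>R One)" "measure lebesgue Q = s ^ ?n"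
    using 2(1) by (rule cubesE)
  \<comment> \<open>Growing the side from \<open>s\<close> to \<open>s / k\<close> multiplies the
    volume by \<open>1 / c\<close>, which produces the factor \<open>c\<close> in the average;
    \<open>d\<close> is the margin on each side of the concentric larger cube
    \<open>R\<close>.\<close>
  define k where "k = root ?n c"
  have k: "0 < k" "k < 1" "k ^ ?n = c"
    using c by (auto simp: k_def real_root_pow_pos2)
  define d where "d = (s / k - s) / 2"
  have d: "0 < d" "s + 2 * d = s / k"
    using s k by (auto simp: d_def field_simps)
  define R where "R = cbox (a - d *\<^sub>R One) ((a - d *\<^sub>R One) + (s / k) *\<^sub>R One)"
  have R: "R \<in> cubes"
    unfolding R_def cubes_def using s k by force
  have mR: "measure lebesgue R = (s / k) ^ ?n"
    using emeasure_lebesgue_cube[of "s / k" "a - d *\<^sub>R One"] s k by (simp add: R_def measure_def)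
  have QR: "Q \<subseteq> interior R"
  proof
    fix y assume "y \<in> Q"
    then have "a \<bullet> b - d < y \<bullet> b \<and> y \<bullet> b < a \<bullet> b - d + s / k" if "b \<in> Basis" for b
      using that d s unfolding Q mem_box by (force simp: inner_add_left)
    then show "y \<in> interior R"
      unfolding R_def interior_cbox by (auto simp: mem_box inner_add_left inner_diff_left)
  qed
  have "w \<in> aumann_integral R F"
    using aumann_integral_subset[OF F, of Q R] QR interior_subset 2(3) by blast
  moreover have "c *\<^sub>R v = (1 / measure lebesgue R) *\<^sub>R w"
    using k s by (simp add: 2(4) Q(2) mR power_divide)
  \<comment> \<open>One and the same average over \<open>R\<close> serves all points of
    \<open>R\<close>, which is a neighbourhood of \<open>x\<close>.\<close>
  ultimately have *: "c *\<^sub>R v \<in> cube_averages F x'" if "x' \<in> R" for x'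
    using cube_averages_intro[OF R that] by simp
  have "eventually (\<lambda>x'. x' \<in> interior R) (nhds x)"
    using QR 2(2) by (intro eventually_nhds_in_open) auto
  then show ?thesis
    by eventually_elim (use interior_subset * in blast)
qed

text \<open>The points \<open>v\<close> with this property form a convex set, since two
  neighbourhoods of \<open>x\<close> intersect in a third, and this set contains the averages; hence
  it contains their hull.\<close>

lemma eventually_convex_hull_cube_averages:
  fixes F :: "'a::euclidean_space \<Rightarrow> 'b::euclidean_space set"
  assumes F: "AE y in lebesgue. 0 \<in> F y" and v: "v \<in> convex hull cube_averages F x"
    and c: "0 < c" "c < 1"
  shows "eventually (\<lambda>x'. c *\<^sub>R v \<in> convex hull cube_averages F x') (nhds x)"
proof -
  let ?W = "{v. eventually (\<lambda>x'. c *\<^sub>R v \<in> convex hull cube_averages F x') (nhds x)}"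
  have "convex ?W"
  proof (rule convexI)
    fix v w :: 'b and p q :: real
    assume vw: "v \<in> ?W" "w \<in> ?W" and pq: "0 \<le> p" "0 \<le> q" "p + q = 1"
    have eq: "c *\<^sub>R (p *\<^sub>R v + q *\<^sub>R w) = p *\<^sub>R (c *\<^sub>R v) + q *\<^sub>R (c *\<^sub>R w)"
      by (simp add: scaleR_add_right mult.commute)
    have "eventually (\<lambda>x'. c *\<^sub>R v \<in> convex hull cube_averages F x') (nhds x)"
      "eventually (\<lambda>x'. c *\<^sub>R w \<in> convex hull cube_averages F x') (nhds x)"
      using vw by auto
    then show "p *\<^sub>R v + q *\<^sub>R w \<in> ?W"
      unfolding mem_Collect_eq eq
      by eventually_elim (use pq in \<open>blast intro: convexD[OF convex_convex_hull]\<close>)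
  qed
  moreover have "cube_averages F x \<subseteq> ?W"
  proof
    fix w assume "w \<in> cube_averages F x"
    from eventually_cube_averages[OF F this c] show "w \<in> ?W"
      unfolding mem_Collect_eq by (rule eventually_mono) (rule hull_inc)
  qed
  ultimately have "convex hull cube_averages F x \<subseteq> ?W"
    by (rule hull_minimal[rotated])
  with v show ?thesis by blast
qed

text \<open>This is lower hemicontinuity of the set-valued map \<open>maximal_op F\<close>, from
  which measurability follows at once.\<close>

lemma open_maximal_op_meets:
  fixes F :: "'a::euclidean_space \<Rightarrow> 'b::euclidean_space set"
  assumes F: "AE y in lebesgue. 0 \<in> F y" and U: "open U"
  shows "open {x. maximal_op F x \<inter> U \<noteq> {}}"
proof -
  let ?H = "\<lambda>x. convex hull cube_averages F x"
  have eq: "{x. maximal_op F x \<inter> U \<noteq> {}} = {x. U \<inter> ?H x \<noteq> {}}" (is "_ = ?S")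
    unfolding maximal_op_eq using open_Int_closure_eq_empty[OF U] by (simp add: Int_commute)
  have "eventually (\<lambda>x'. x' \<in> ?S) (nhds x)" if x: "x \<in> ?S" for x
  proof -
    obtain v where v: "v \<in> U" "v \<in> ?H x" using x by blast
    \<comment> \<open>\<open>U\<close> is open, so shrinking \<open>v\<close> slightly keeps it in
      \<open>U\<close>; the strict bound \<open>c < 1\<close> pays for the enlargement of the
      cubes.\<close>
    have "((\<lambda>c. c *\<^sub>R v) \<longlongrightarrow> 1 *\<^sub>R v) (at_left 1)"
      by (intro tendsto_intros)
    then have "eventually (\<lambda>c. c *\<^sub>R v \<in> U) (at_left (1::real))"
      using U v by (intro topological_tendstoD) auto
    moreover have "eventually (\<lambda>c. c \<in> {0<..<1}) (at_left (1::real))"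
      by (rule eventually_at_leftI[of 0]) auto
    ultimately have "eventually (\<lambda>c. c *\<^sub>R v \<in> U \<and> c \<in> {0<..<1}) (at_left (1::real))"
      by (rule eventually_conj)
    then obtain c where c: "c *\<^sub>R v \<in> U" "0 < c" "c < 1"
      using eventually_happens'[OF trivial_limit_at_left_real] by auto
    from eventually_convex_hull_cube_averages[OF F v(2) c(2,3)] show ?thesis
      by eventually_elim (use c in auto)
  qed
  then have "\<forall>x\<in>?S. eventually (\<lambda>x'. x' \<in> ?S) (nhds x)"
    by (rule ballI)
  then have "open ?S"
    unfolding eventually_nhds open_subopen[of ?S] subset_eq .
  then show ?thesis unfolding eq .
qed

section \<open>Measurability of the maximal operator and the nature of its values\<close>

lemma set_measurable_maximal_op:
  assumes "AE y in lebesgue. 0 \<in> F y"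
  shows "set_measurable (maximal_op F)"
  unfolding set_measurable_def using open_maximal_op_meets[OF assms]
  by (simp add: sets_completionI_sets)

text \<open>The negative of a selection is a selection, and negation, being linear, commutes with
  closed convex hulls.\<close>

lemma uminus_maximal_op:
  assumes "AE y in lebesgue. F y \<in> bcs_sets"
  shows "uminus ` maximal_op F x = maximal_op F x"
proof -
  have sub: "uminus ` cube_averages F x \<subseteq> cube_averages F x"
  proof safe
    fix v assume "v \<in> cube_averages F x"
    then show "- v \<in> cube_averages F x"
    proof (cases rule: cube_averages_cases)
      case 1
      then show ?thesis using zero_mem_cube_averages[OF AE_zero_mem[OF assms]] by simp
    next
      case (2 Q w)
      then show ?thesis
        using cube_averages_intro[OF 2(1,2) uminus_mem_aumann_integral[OF assms 2(3)]] by simp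
    qed
  qed
  then have "uminus ` cube_averages F x = cube_averages F x"
    by (force simp: image_iff)
  moreover have u: "uminus = (\<lambda>v::'b. (-1) *\<^sub>R v)"
    by auto
  have "uminus ` closure (convex hull A) = closure (convex hull (uminus ` A))" for A :: "'b set"
    unfolding u by (simp only: closure_scaleR convex_hull_scaling)
  ultimately show ?thesis
    unfolding maximal_op_eq by simp
qed

text \<open>Nonemptiness, closedness, convexity and symmetry hold at every point; boundedness is
  what finiteness of the norm adds.\<close>

lemma maximal_op_mem_bcs_sets:
  assumes F: "AE y in lebesgue. F y \<in> bcs_sets" and fin: "set_norm (maximal_op F x) < \<infinity>"
  shows "maximal_op F x \<in> bcs_sets"
proof -
  obtain B where B: "0 \<le> B" "set_norm (maximal_op F x) = ennreal B"
    using fin by (cases "set_norm (maximal_op F x)") auto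
  then have "norm v \<le> B" if "v \<in> maximal_op F x" for v
    using that by (metis SUP_upper ennreal_le_iff set_norm_def)
  then have "bounded (maximal_op F x)"
    unfolding bounded_iff by blast
  moreover have "maximal_op F x \<noteq> {}"
    using zero_mem_cube_averages[OF AE_zero_mem[OF F]] by (auto simp: maximal_op_eq)
  ultimately show ?thesis
    using uminus_maximal_op[OF F] by (auto simp: bcs_sets_def maximal_op_eq convex_closure)
qed

text \<open>If all averages at \<open>x\<close> had norm at most \<open>t\<close>, the closed convex
  ball \<open>cball 0 t\<close> would contain their closed convex hull. So one average is already
  longer than \<open>t\<close>, and the problem becomes scalar.\<close>

lemma cube_of_less_set_norm_maximal_op:
  fixes F :: "'a::euclidean_space \<Rightarrow> 'b::euclidean_space set"
  assumes t: "0 \<le> t" and less: "ennreal t < set_norm (maximal_op F x)"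
  obtains Q where "Q \<in> cubes" "x \<in> Q"
    "ennreal t * emeasure lebesgue Q < (\<integral>\<^sup>+y\<in>Q. set_norm (F y) \<partial>lebesgue)"
proof -
  have "\<exists>v\<in>cube_averages F x. t < norm v"
  proof (rule ccontr)
    assume "\<not> ?thesis"
    then have "cube_averages F x \<subseteq> cball 0 t" by auto
    then have "maximal_op F x \<subseteq> cball 0 t"
      unfolding maximal_op_eq by (intro closure_minimal hull_minimal) auto
    then have "maximal_op F x \<inter> {v. t < norm v} = {}" by auto
    with less show False by (simp add: less_set_norm_iff[OF t])
  qed
  then obtain v where v: "v \<in> cube_averages F x" "t < norm v" by blast
  from v(1) show thesis
  proof (cases rule: cube_averages_cases)
    \<comment> \<open>The zero average of a cube missing \<open>x\<close> is excluded by
      \<open>0 \<le> t\<close> and \<open>t < norm v\<close>.\<close>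
    case 1
    then show ?thesis using v t by simp
  next
    case (2 Q w)
    obtain s where s: "0 < s" "measure lebesgue Q = s ^ DIM('a)"
        "emeasure lebesgue Q = ennreal (s ^ DIM('a))"
      using 2(1) by (rule cubesE)
    have "t * s ^ DIM('a) < norm w"
      using v(2) s by (simp add: 2(4) field_simps)
    then have "ennreal t * emeasure lebesgue Q < ennreal (norm w)"
      unfolding s(3) using t s by (simp add: ennreal_mult[symmetric] ennreal_less_iff)
    also have "\<dots> \<le> (\<integral>\<^sup>+y\<in>Q. set_norm (F y) \<partial>lebesgue)"
      by (rule norm_aumann_integral_le) (rule 2(3))
    finally show ?thesis using that 2 by blast
  qed
qed


section \<open>From weak type to strong type\<close>

lemma ennpowr_1: "ennpowr x 1 = x"
  by (cases x) (auto simp: ennpowr_def)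

lemma ennpowr_mono: "0 \<le> r \<Longrightarrow> x \<le> y \<Longrightarrow> ennpowr x r \<le> ennpowr y r"
  by (cases x; cases y) (auto simp: ennpowr_def top_unique intro!: ennreal_leI powr_mono2)

lemma ennpowr_less_top_iff: "ennpowr x r < \<infinity> \<longleftrightarrow> x < \<infinity>"
  by (auto simp: ennpowr_def less_top)

lemma ennpowr_cmult:
  assumes "0 < c"
  shows "ennpowr (ennreal c * x) r = ennreal (c powr r) * ennpowr x r"
  using assms
  by (cases x) (auto simp: ennpowr_def ennreal_mult_top ennreal_mult[symmetric] powr_mult)

lemma borel_measurable_ennpowr [measurable]:
  assumes [measurable]: "f \<in> borel_measurable M"
  shows "(\<lambda>x. ennpowr (f x) r) \<in> borel_measurable M"
  unfolding ennpowr_def by measurable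

text \<open>The layer-cake formula for powers. The range \<open>0 < s < y\<close> is put into the
  integrand so that the order of integration can be exchanged.\<close>

lemma nn_integral_powr_less:
  fixes y :: ennreal
  assumes r: "0 < r"
  shows "(\<integral>\<^sup>+s. (if 0 < s \<and> ennreal s < y then ennreal (s powr (r - 1)) else 0) \<partial>lborel)
    = ennreal (1 / r) * ennpowr y r"
proof -
  have fin: "(\<integral>\<^sup>+s. (if 0 < s \<and> ennreal s < ennreal c then ennreal (s powr (r - 1)) else 0) \<partial>lborel)
      = ennreal (c powr r / r)" if c: "0 \<le> c" for c
  proof -
    \<comment> \<open>The two integrands can differ only at the endpoints 0 and \<open>c\<close>,
      which are null.\<close>
    have "AE s in lborel. (if 0 < s \<and> ennreal s < ennreal c then ennreal (s powr (r - 1)) else 0)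
        = ennreal (s powr (r - 1)) * indicator {0..c} s"
      using AE_lborel_singleton[of 0] AE_lborel_singleton[of c]
      by eventually_elim (use c in \<open>auto simp: ennreal_less_iff split: split_indicator\<close>)
    then have "(\<integral>\<^sup>+s. (if 0 < s \<and> ennreal s < ennreal c then ennreal (s powr (r - 1)) else 0) \<partial>lborel)
        = (\<integral>\<^sup>+s. ennreal (s powr (r - 1)) * indicator {0..c} s \<partial>lborel)"
      by (rule nn_integral_cong_AE)
    also have "\<dots> = ennreal (c powr r / r)"
      using has_integral_powr_from_0[of "r - 1" c] r c
      by (intro nn_integral_has_integral_lebesgue') auto
    finally show ?thesis .
  qed
  show ?thesis
  proof (cases y)
    case (real c)
    then show ?thesis
      using fin[of c] r by (simp add: ennpowr_def ennreal_mult[symmetric] field_simps)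
  next
    case top
    let ?I = "\<integral>\<^sup>+s. (if 0 < s \<and> ennreal s < y then ennreal (s powr (r - 1)) else 0) \<partial>lborel"
    have "?I = \<infinity>"
    proof (rule ccontr)
      assume "?I \<noteq> \<infinity>"
      then obtain B where B: "0 \<le> B" "?I = ennreal B" by (cases ?I) auto
      \<comment> \<open>\<open>c\<close> is chosen so that the part below \<open>c\<close> already
        integrates to \<open>B + 1\<close>.\<close>
      define c where "c = ((B + 1) * r) powr (1 / r)"
      have "c powr r / r = B + 1"
        using B r by (simp add: c_def powr_powr)
      then have "ennreal (B + 1) =
          (\<integral>\<^sup>+s. (if 0 < s \<and> ennreal s < ennreal c then ennreal (s powr (r - 1)) else 0) \<partial>lborel)"
        using fin[of c] by (simp add: c_def)
      also have "\<dots> \<le> ?I"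
        using top by (intro nn_integral_mono) auto
      finally show False using B by (simp add: ennreal_le_iff)
    qed
    then show ?thesis
      using top r by (simp add: ennpowr_def ennreal_mult_top)
  qed
qed

text \<open>In the interpolation this recombines the factor \<open>g x\<close> of the truncated weak
  bound with the power of \<open>2 * g x\<close> left by integrating over the heights.\<close>

lemma mult_ennpowr_2_mult:
  assumes "1 < p"
  shows "x * ennpowr (2 * x) (p - 1) = ennreal (2 powr (p - 1)) * ennpowr x p"
proof (cases x)
  case (real c)
  have "c * (2 * c) powr (p - 1) = 2 powr (p - 1) * c powr p"
    using real(1) assms by (cases "c = 0") (simp_all add: powr_mult powr_diff)
  moreover have "2 * ennreal c = ennreal (2 * c)"
    using real by (simp add: ennreal_mult)
  ultimately show ?thesis
    using real by (simp add: ennpowr_def ennreal_mult[symmetric])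
next
  case top
  then show ?thesis
    by (simp add: ennpowr_def ennreal_mult_top ennreal_top_mult)
qed

text \<open>
  Marcinkiewicz interpolation: the hypothesis is what a weak (1,1) bound gives for a sublinear
  operator of norm at most 1 on \<open>L\<^sup>\<infinity>\<close>, after splitting \<open>g\<close> at height \<open>t/2\<close>.
\<close>

lemma nn_integral_ennpowr_le_of_truncated_weak_type:
  assumes "sigma_finite_measure M"
    and [measurable]: "G \<in> borel_measurable M" "g \<in> borel_measurable M"
    and K: "0 \<le> K" and p: "1 < p"
    and weak: "\<And>t. 0 < t \<Longrightarrow> emeasure M {x \<in> space M. ennreal t < G x} \<le>
      ennreal (K / t) * (\<integral>\<^sup>+x. (if ennreal t < 2 * g x then g x else 0) \<partial>M)"
  shows "(\<integral>\<^sup>+x. ennpowr (G x) p \<partial>M) \<le>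
    ennreal (p * (K * (1 / (p - 1) * 2 powr (p - 1)))) * (\<integral>\<^sup>+x. ennpowr (g x) p \<partial>M)"
proof -
  have const: "ennreal (K * (1 / (p - 1) * 2 powr (p - 1))) =
      ennreal K * (ennreal (1 / (p - 1)) * ennreal (2 powr (p - 1)))"
    using p by (subst ennreal_mult[OF K], simp, subst ennreal_mult) auto
  interpret M: sigma_finite_measure M by fact
  interpret pair_sigma_finite lborel M ..
  \<comment> \<open>Layer cake at exponent \<open>p\<close>; the outer \<open>p\<close> cancels the
    factor \<open>1 / p\<close>.\<close>
  have "(\<integral>\<^sup>+x. ennpowr (G x) p \<partial>M) = (\<integral>\<^sup>+x. ennreal p *
      (\<integral>\<^sup>+s. (if 0 < s \<and> ennreal s < G x then ennreal (s powr (p - 1)) else 0) \<partial>lborel) \<partial>M)"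
    using p by (subst nn_integral_powr_less)
      (auto simp: mult.assoc[symmetric] ennreal_mult[symmetric] intro!: nn_integral_cong)
  also have "\<dots> = ennreal p *
      (\<integral>\<^sup>+x. \<integral>\<^sup>+s. (if 0 < s \<and> ennreal s < G x then ennreal (s powr (p - 1)) else 0) \<partial>lborel \<partial>M)"
    by (rule nn_integral_cmult) measurable
  also have "(\<integral>\<^sup>+x. \<integral>\<^sup>+s. (if 0 < s \<and> ennreal s < G x then ennreal (s powr (p - 1)) else 0) \<partial>lborel \<partial>M)
      = (\<integral>\<^sup>+s. \<integral>\<^sup>+x. (if 0 < s \<and> ennreal s < G x then ennreal (s powr (p - 1)) else 0) \<partial>M \<partial>lborel)"
    by (rule Fubini') measurable
  \<comment> \<open>The factor \<open>1 / s\<close> of the weak bound lowers the exponent of the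
    weight by one. The form \<open>p - 1 - 1\<close> matches the layer-cake formula at exponent
    \<open>p - 1\<close>, positive because \<open>1 < p\<close>, which later evaluates the integral
    over heights up to \<open>2 * g x\<close>.\<close>
  also have "\<dots> \<le> (\<integral>\<^sup>+s. \<integral>\<^sup>+x.
      (if 0 < s \<and> ennreal s < 2 * g x then ennreal (s powr (p - 1 - 1)) else 0) * (ennreal K * g x) \<partial>M \<partial>lborel)"
  proof (rule nn_integral_mono)
    fix s :: real
    show "(\<integral>\<^sup>+x. (if 0 < s \<and> ennreal s < G x then ennreal (s powr (p - 1)) else 0) \<partial>M) \<le>
      (\<integral>\<^sup>+x. (if 0 < s \<and> ennreal s < 2 * g x then ennreal (s powr (p - 1 - 1)) else 0) * (ennreal K * g x) \<partial>M)"
    proof (cases "0 < s")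
      case True
      have "(\<integral>\<^sup>+x. (if 0 < s \<and> ennreal s < G x then ennreal (s powr (p - 1)) else 0) \<partial>M) =
          (\<integral>\<^sup>+x. ennreal (s powr (p - 1)) * indicator {x \<in> space M. ennreal s < G x} x \<partial>M)"
        using True by (intro nn_integral_cong) auto
      also have "\<dots> = ennreal (s powr (p - 1)) * emeasure M {x \<in> space M. ennreal s < G x}"
        by (rule nn_integral_cmult_indicator) measurable
      also have "\<dots> \<le> ennreal (s powr (p - 1)) *
          (ennreal (K / s) * (\<integral>\<^sup>+x. (if ennreal s < 2 * g x then g x else 0) \<partial>M))"
        by (intro mult_left_mono weak True) auto
      also have "\<dots> = ennreal (s powr (p - 1 - 1) * K) * (\<integral>\<^sup>+x. (if ennreal s < 2 * g x then g x else 0) \<partial>M)"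
        using True K by (simp add: mult.assoc[symmetric] ennreal_mult[symmetric] powr_diff power2_eq_square)
      also have "\<dots> = (\<integral>\<^sup>+x. ennreal (s powr (p - 1 - 1) * K) * (if ennreal s < 2 * g x then g x else 0) \<partial>M)"
        by (rule nn_integral_cmult[symmetric]) measurable
      also have "\<dots> = (\<integral>\<^sup>+x. (if 0 < s \<and> ennreal s < 2 * g x then ennreal (s powr (p - 1 - 1)) else 0) * (ennreal K * g x) \<partial>M)"
        using True K by (intro nn_integral_cong) (auto simp: ennreal_mult mult.assoc)
      finally show ?thesis .
    qed simp
  qed
  also have "\<dots> = (\<integral>\<^sup>+x. \<integral>\<^sup>+s.
      (if 0 < s \<and> ennreal s < 2 * g x then ennreal (s powr (p - 1 - 1)) else 0) * (ennreal K * g x) \<partial>lborel \<partial>M)"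
    by (rule Fubini'[symmetric]) measurable
  also have "\<dots> = (\<integral>\<^sup>+x. ennreal (K * (1 / (p - 1) * 2 powr (p - 1))) * ennpowr (g x) p \<partial>M)"
  proof (rule nn_integral_cong)
    fix x
    have "(\<integral>\<^sup>+s. (if 0 < s \<and> ennreal s < 2 * g x then ennreal (s powr (p - 1 - 1)) else 0) * (ennreal K * g x) \<partial>lborel)
      = ennreal (1 / (p - 1)) * ennpowr (2 * g x) (p - 1) * (ennreal K * g x)"
      using p by (subst nn_integral_multc) (measurable, simp add: nn_integral_powr_less)
    also have "\<dots> = ennreal K * (ennreal (1 / (p - 1)) * (g x * ennpowr (2 * g x) (p - 1)))"
      by (simp add: mult_ac)
    also have "\<dots> = ennreal (K * (1 / (p - 1) * 2 powr (p - 1))) * ennpowr (g x) p"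
      unfolding mult_ennpowr_2_mult[OF p] const by (simp only: mult.assoc)
    finally show "(\<integral>\<^sup>+s. (if 0 < s \<and> ennreal s < 2 * g x then ennreal (s powr (p - 1 - 1)) else 0) * (ennreal K * g x) \<partial>lborel)
      = ennreal (K * (1 / (p - 1) * 2 powr (p - 1))) * ennpowr (g x) p" .
  qed
  also have "\<dots> = ennreal (K * (1 / (p - 1) * 2 powr (p - 1))) * (\<integral>\<^sup>+x. ennpowr (g x) p \<partial>M)"
    by (rule nn_integral_cmult) measurable
  finally have "(\<integral>\<^sup>+x. ennpowr (G x) p \<partial>M) \<le> ennreal p *
      (ennreal (K * (1 / (p - 1) * 2 powr (p - 1))) * (\<integral>\<^sup>+x. ennpowr (g x) p \<partial>M))"
    by (simp only: mult_left_mono zero_le)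
  moreover have "ennreal (p * (K * (1 / (p - 1) * 2 powr (p - 1)))) =
      ennreal p * ennreal (K * (1 / (p - 1) * 2 powr (p - 1)))"
    using p K by (intro ennreal_mult) auto
  ultimately show ?thesis
    by (simp only: mult.assoc)
qed


section \<open>Boundedness of the maximal operator\<close>

text \<open>With \<open>g\<close> for |F| and \<open>h\<close> for its part above
  \<open>t / 2\<close>, \<open>g\<close> is at most \<open>h + t / 2\<close>, so a cube on which
  \<open>g\<close> averages above \<open>t\<close> has \<open>h\<close> averaging above
  \<open>t / 2\<close>. The covering estimate at that height brings in the factor 2.\<close>

lemma weak_type_maximal_op:
  fixes F :: "'a::euclidean_space \<Rightarrow> 'b::euclidean_space set"
  assumes F: "set_measurable F" and t: "0 < t"
  shows "emeasure lebesgue {x. ennreal t < set_norm (maximal_op F x)} \<le>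
    ennreal (2 * vitali_const TYPE('a) / t) *
      (\<integral>\<^sup>+x. (if ennreal t < 2 * set_norm (F x) then set_norm (F x) else 0) \<partial>lebesgue)"
proof -
  let ?g = "\<lambda>x. set_norm (F x)"
  let ?h = "\<lambda>x. if ennreal t < 2 * ?g x then ?g x else 0"
  note [measurable] = borel_measurable_set_norm[OF F]
  have h [measurable]: "?h \<in> borel_measurable lebesgue"
    by measurable
  have half: "ennreal (t / 2) + ennreal (t / 2) = ennreal t"
    using t by (simp add: ennreal_plus[symmetric] del: ennreal_plus)
  have "emeasure lebesgue {x. ennreal t < set_norm (maximal_op F x)} \<le>
      ennreal (vitali_const TYPE('a) / (t / 2)) * (\<integral>\<^sup>+x. ?h x \<partial>lebesgue)"
  proof (rule weak_type_cubes[OF h])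
    fix x assume "x \<in> {x. ennreal t < set_norm (maximal_op F x)}"
    then obtain Q where Q: "Q \<in> cubes" "x \<in> Q"
      "ennreal t * emeasure lebesgue Q < (\<integral>\<^sup>+y\<in>Q. ?g y \<partial>lebesgue)"
      using t by (auto elim!: cube_of_less_set_norm_maximal_op[rotated])
    have [measurable]: "Q \<in> sets lebesgue"
      using Q(1) by (rule cubesE)
    have le: "?g y \<le> ?h y + ennreal (t / 2)" for y
    proof (cases "?g y")
      case (real c)
      then have "2 * ?g y = ennreal (2 * c)" by (simp add: ennreal_mult)
      then show ?thesis using real t by (auto simp: ennreal_less_iff intro: ennreal_leI)
    next
      case top
      then show ?thesis by (simp add: ennreal_mult_top)
    qed
    have "(\<integral>\<^sup>+y\<in>Q. ?g y \<partial>lebesgue) \<le> (\<integral>\<^sup>+y. ?h y * indicator Q y + ennreal (t / 2) * indicator Q y \<partial>lebesgue)"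
      unfolding distrib_right[symmetric] using le by (intro nn_integral_mono mult_right_mono) auto
    also have "\<dots> = (\<integral>\<^sup>+y\<in>Q. ?h y \<partial>lebesgue) + (\<integral>\<^sup>+y. ennreal (t / 2) * indicator Q y \<partial>lebesgue)"
      by (rule nn_integral_add) measurable
    also have "(\<integral>\<^sup>+y. ennreal (t / 2) * indicator Q y \<partial>lebesgue) = ennreal (t / 2) * emeasure lebesgue Q"
      by (rule nn_integral_cmult_indicator) measurable
    finally have *: "ennreal t * emeasure lebesgue Q <
        (\<integral>\<^sup>+y\<in>Q. ?h y \<partial>lebesgue) + ennreal (t / 2) * emeasure lebesgue Q"
      using Q(3) by (rule less_le_trans[rotated])
    \<comment> \<open>Instead of cancelling in \<open>ennreal\<close>, the negated claim is added
      up: two halves of \<open>t\<close> give \<open>t\<close>, against the strict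
      inequality.\<close>
    have "ennreal (t / 2) * emeasure lebesgue Q < (\<integral>\<^sup>+y\<in>Q. ?h y \<partial>lebesgue)"
    proof (rule ccontr)
      assume "\<not> ?thesis"
      then have "(\<integral>\<^sup>+y\<in>Q. ?h y \<partial>lebesgue) + ennreal (t / 2) * emeasure lebesgue Q
          \<le> (ennreal (t / 2) + ennreal (t / 2)) * emeasure lebesgue Q"
        unfolding distrib_right by (intro add_right_mono) simp
      with * show False unfolding half by simp
    qed
    with Q(1,2) show "\<exists>Q\<in>cubes. x \<in> Q \<and> ennreal (t / 2) * emeasure lebesgue Q < (\<integral>\<^sup>+y\<in>Q. ?h y \<partial>lebesgue)"
      by blast
  qed (use t in simp)
  then show ?thesis by (simp add: mult.commute)
qed

text \<open>Averages do not see null sets, so the bound holds at every point and with constant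
  1.\<close>

lemma set_norm_maximal_op_le_esssup:
  assumes F: "set_measurable F"
  shows "set_norm (maximal_op F x) \<le> esssup lebesgue (\<lambda>x. set_norm (F x))"
proof (rule ccontr)
  let ?G = "esssup lebesgue (\<lambda>x. set_norm (F x))"
  assume less: "\<not> ?thesis"
  \<comment> \<open>\<open>?G\<close> lies strictly below another value, so it is finite.\<close>
  then obtain t where t: "0 \<le> t" "?G = ennreal t"
    by (cases ?G) auto
  obtain Q where Q: "Q \<in> cubes"
      "ennreal t * emeasure lebesgue Q < (\<integral>\<^sup>+y\<in>Q. set_norm (F y) \<partial>lebesgue)"
    using less t by (auto simp: not_le intro: cube_of_less_set_norm_maximal_op[OF t(1), of F x])
  have "(\<integral>\<^sup>+y\<in>Q. set_norm (F y) \<partial>lebesgue) \<le> (\<integral>\<^sup>+y. ennreal t * indicator Q y \<partial>lebesgue)"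
  proof (rule nn_integral_mono_AE)
    show "AE y in lebesgue. set_norm (F y) * indicator Q y \<le> ennreal t * indicator Q y"
      using esssup_AE[of "\<lambda>x. set_norm (F x)" lebesgue] unfolding t(2)
      by eventually_elim (simp add: mult_right_mono)
  qed
  also have "\<dots> = ennreal t * emeasure lebesgue Q"
    using Q(1) by (intro nn_integral_cmult_indicator) (rule cubesE)
  finally show False using Q(2) by simp
qed

lemma maximal_op_LpK_infinity:
  assumes "F \<in> LpK \<infinity>"
  shows "maximal_op F \<in> LpK \<infinity> \<and> LpK_norm \<infinity> (maximal_op F) \<le> LpK_norm \<infinity> F"
proof -
  have F: "set_measurable F" "AE x in lebesgue. F x \<in> bcs_sets" "LpK_norm \<infinity> F < \<infinity>"
    using assms by (auto simp: LpK_def)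
  have meas: "set_measurable (maximal_op F)"
    by (intro set_measurable_maximal_op AE_zero_mem F)
  have le: "LpK_norm \<infinity> (maximal_op F) \<le> LpK_norm \<infinity> F"
    unfolding LpK_norm_def using borel_measurable_set_norm[OF meas] set_norm_maximal_op_le_esssup[OF F(1)]
    by (auto intro!: esssup_I)
  have "maximal_op F x \<in> bcs_sets" for x
    using set_norm_maximal_op_le_esssup[OF F(1), of x] F(3)
    by (intro maximal_op_mem_bcs_sets[OF F(2)]) (auto simp: LpK_norm_def)
  with meas le F(3) show ?thesis
    by (auto simp: LpK_def)
qed

text \<open>\<open>C\<close> is the interpolation constant for \<open>K = 2 * vitali_const\<close>.
  It compares integrals of powers, so the norms are compared with its root of order
  \<open>p\<close>.\<close>

lemma maximal_op_LpK_finite: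
  fixes F :: "'a::euclidean_space \<Rightarrow> 'b::euclidean_space set"
  assumes p: "1 < p" and F: "F \<in> LpK (ennreal p)"
  defines "C \<equiv> p * (2 * vitali_const TYPE('a) * (1 / (p - 1) * 2 powr (p - 1)))"
  shows "maximal_op F \<in> LpK (ennreal p) \<and>
    LpK_norm (ennreal p) (maximal_op F) \<le> ennreal (C powr (1 / p)) * LpK_norm (ennreal p) F"
proof -
  let ?J = "\<lambda>F. \<integral>\<^sup>+x. ennpowr (set_norm (F x)) p \<partial>lebesgue"
  have F: "set_measurable F" "AE x in lebesgue. F x \<in> bcs_sets" "LpK_norm (ennreal p) F < \<infinity>"
    using F by (auto simp: LpK_def)
  have norm: "LpK_norm (ennreal p) H = ennpowr (?J H) (1 / p)" for H :: "'a \<Rightarrow> 'b set"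
    using p by (simp add: LpK_norm_def)
  have C: "0 < C"
    unfolding C_def using p vitali_const_pos[where ?'a='a] by simp
  have meas: "set_measurable (maximal_op F)"
    by (intro set_measurable_maximal_op AE_zero_mem F)
  note [measurable] = borel_measurable_set_norm[OF meas]
  have le: "?J (maximal_op F) \<le> ennreal C * ?J F"
    unfolding C_def
  proof (rule nn_integral_ennpowr_le_of_truncated_weak_type)
    show "sigma_finite_measure (lebesgue :: 'a measure)"
      by (intro sigma_finite_measure_completion lborel.sigma_finite_measure_axioms)
  qed (use p vitali_const_pos[where ?'a='a] weak_type_maximal_op[OF F(1)] borel_measurable_set_norm F(1) meas
        in \<open>auto simp del: emeasure_completion\<close>)
  have "LpK_norm (ennreal p) (maximal_op F) \<le> ennpowr (ennreal C * ?J F) (1 / p)"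
    unfolding norm using p by (intro ennpowr_mono le) auto
  then have norm_le: "LpK_norm (ennreal p) (maximal_op F) \<le> ennreal (C powr (1 / p)) * LpK_norm (ennreal p) F"
    unfolding norm ennpowr_cmult[OF C] .
  also have "\<dots> < \<infinity>"
    using F(3) by (simp add: ennreal_mult_less_top)
  finally have fin: "LpK_norm (ennreal p) (maximal_op F) < \<infinity>" .
  \<comment> \<open>A finite integral forces a finite integrand almost everywhere, hence bounded
    values there.\<close>
  then have "?J (maximal_op F) \<noteq> \<infinity>"
    unfolding norm ennpowr_less_top_iff by simp
  then have "AE x in lebesgue. ennpowr (set_norm (maximal_op F x)) p \<noteq> \<infinity>"
    by (intro nn_integral_PInf_AE) measurable
  then have "AE x in lebesgue. maximal_op F x \<in> bcs_sets"
  proof eventually_elim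
    case (elim x)
    then show ?case
      using ennpowr_less_top_iff[of "set_norm (maximal_op F x)" p]
      by (intro maximal_op_mem_bcs_sets[OF F(2)]) (simp add: less_top)
  qed
  with meas fin norm_le show ?thesis
    by (simp add: LpK_def)
qed

text \<open>The truncated integral is at most the full one. The values are bounded almost everywhere
  because the set where |MF| is infinite lies in all superlevel sets, whose measures tend to
  0.\<close>

lemma maximal_op_weak_L1K:
  fixes F :: "'a::euclidean_space \<Rightarrow> 'b::euclidean_space set"
  assumes "F \<in> LpK 1"
  shows "maximal_op F \<in> weak_L1K \<and>
    (\<forall>t::real. 0 < t \<longrightarrow> emeasure lebesgue {x. set_norm (maximal_op F x) > ennreal t}
      \<le> ennreal (2 * vitali_const TYPE('a) / t) * (\<integral>\<^sup>+x. set_norm (F x) \<partial>lebesgue))"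
proof -
  let ?g = "\<lambda>x. set_norm (F x)"
  let ?C = "2 * vitali_const TYPE('a)"
  define J where "J = (\<integral>\<^sup>+x. ?g x \<partial>lebesgue)"
  have F: "set_measurable F" "AE x in lebesgue. F x \<in> bcs_sets" "J < \<infinity>"
    using assms by (auto simp: LpK_def LpK_norm_def ennpowr_1 J_def)
  have C: "0 < ?C" using vitali_const_pos[where ?'a='a] by simp
  have meas: "set_measurable (maximal_op F)"
    by (intro set_measurable_maximal_op AE_zero_mem F)
  note [measurable] = borel_measurable_set_norm[OF meas]
  have weak: "emeasure lebesgue {x. ennreal t < set_norm (maximal_op F x)} \<le> ennreal (?C / t) * J"
    if "0 < t" for t
  proof -
    have "(\<integral>\<^sup>+x. (if ennreal t < 2 * ?g x then ?g x else 0) \<partial>lebesgue) \<le> J"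
      unfolding J_def by (intro nn_integral_mono) auto
    then show ?thesis
      using weak_type_maximal_op[OF F(1) that] by (meson mult_left_mono order_trans zero_le)
  qed
  have "weak_L1K_norm (maximal_op F) \<le> ennreal ?C * J"
    unfolding weak_L1K_norm_def
  proof (rule SUP_least)
    fix t :: real assume "t \<in> {0<..}"
    then have t: "0 < t" by simp
    have "ennreal t * emeasure lebesgue {x. ennreal t < set_norm (maximal_op F x)}
        \<le> ennreal t * (ennreal (?C / t) * J)"
      by (intro mult_left_mono weak t) auto
    also have "\<dots> = ennreal ?C * J"
      using t C by (simp add: mult.assoc[symmetric] ennreal_mult[symmetric])
    finally show "ennreal t * emeasure lebesgue {x. ennreal t < set_norm (maximal_op F x)} \<le> ennreal ?C * J" .
  qed
  also have "\<dots> < \<infinity>"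
    using F(3) by (simp add: ennreal_mult_less_top)
  finally have fin: "weak_L1K_norm (maximal_op F) < \<infinity>" .
  let ?N = "{x \<in> space lebesgue. set_norm (maximal_op F x) = \<infinity>}"
  have small: "emeasure lebesgue ?N \<le> ennreal e" if e: "0 < e" for e
  proof -
    obtain j where j: "0 \<le> j" "J = ennreal j" using F(3) by (cases J) auto
    \<comment> \<open>This height makes the weak bound equal to \<open>e * (j / (j + 1))\<close>, at
      most \<open>e\<close>; the summand 1 keeps \<open>t\<close> positive when
      \<open>j = 0\<close>.\<close>
    define t where "t = ?C * (j + 1) / e"
    have t: "0 < t" using C j e by (simp add: t_def)
    have "emeasure lebesgue ?N \<le> emeasure lebesgue {x \<in> space lebesgue. ennreal t < set_norm (maximal_op F x)}"
      by (rule emeasure_mono, force, measurable)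
    also have "\<dots> \<le> ennreal (?C / t) * J"
      using weak[OF t] by (simp del: emeasure_completion)
    also have "\<dots> = ennreal (e * (j / (j + 1)))"
      using j C t e by (simp add: t_def ennreal_mult[symmetric] field_simps)
    also have "\<dots> \<le> ennreal e"
      using j e by (intro ennreal_leI mult_left_le) auto
    finally show ?thesis .
  qed
  have "emeasure lebesgue ?N \<le> 0"
    by (rule ennreal_le_epsilon) (simp only: add_0 small)
  then have null: "emeasure lebesgue ?N = 0"
    by (simp only: le_zero_eq)
  have N: "?N \<in> sets lebesgue"
    by (rule borel_measurable_eq) measurable
  have "AE x in lebesgue. set_norm (maximal_op F x) \<noteq> \<infinity>"
    by (rule AE_I[OF _ null N]) simp
  then have "AE x in lebesgue. maximal_op F x \<in> bcs_sets"
    by eventually_elim (auto intro!: maximal_op_mem_bcs_sets[OF F(2)] simp: less_top)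
  with meas fin weak show ?thesis
    by (auto simp: weak_L1K_def J_def simp del: emeasure_completion)
qed

theorem theorem5p10:
  shows "(\<forall>p::ennreal. 1 < p \<longrightarrow>
            (\<exists>C::real. 0 \<le> C \<and>
              (\<forall>F :: real^'n \<Rightarrow> (real^'d) set. F \<in> LpK p \<longrightarrow>
                 maximal_op F \<in> LpK p \<and>
                 LpK_norm p (maximal_op F) \<le> ennreal C * LpK_norm p F)))
       \<and> (\<exists>C::real. 0 \<le> C \<and>
            (\<forall>F :: real^'n \<Rightarrow> (real^'d) set. F \<in> LpK 1 \<longrightarrow>
               maximal_op F \<in> weak_L1K \<and>
               (\<forall>t::real. 0 < t \<longrightarrow>
                  emeasure lebesgue {x. set_norm (maximal_op F x) > ennreal t}
                    \<le> ennreal (C / t) * (\<integral>\<^sup>+x. set_norm (F x) \<partial>lebesgue))))"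
proof (intro conjI allI impI)
  fix p :: ennreal assume p: "1 < p"
  show "\<exists>C::real. 0 \<le> C \<and> (\<forall>F :: real^'n \<Rightarrow> (real^'d) set. F \<in> LpK p \<longrightarrow>
      maximal_op F \<in> LpK p \<and> LpK_norm p (maximal_op F) \<le> ennreal C * LpK_norm p F)"
  proof (cases p)
    case (real q)
    then have "1 < q" using p by simp
    show ?thesis
      unfolding real(2)
      \<comment> \<open>The witness stays schematic until unified with the constant of the finite
        case, a real power and hence nonnegative.\<close>
      by (rule exI, rule conjI[OF _ allI[OF impI[OF maximal_op_LpK_finite[OF \<open>1 < q\<close>]]]], rule powr_ge_zero)
  next
    case top
    show ?thesis
      unfolding top using maximal_op_LpK_infinity
      by (intro exI[of _ 1] conjI allI impI) auto
  qed
next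
  show "\<exists>C::real. 0 \<le> C \<and>
            (\<forall>F :: real^'n \<Rightarrow> (real^'d) set. F \<in> LpK 1 \<longrightarrow>
               maximal_op F \<in> weak_L1K \<and>
               (\<forall>t::real. 0 < t \<longrightarrow>
                  emeasure lebesgue {x. set_norm (maximal_op F x) > ennreal t}
                    \<le> ennreal (C / t) * (\<integral>\<^sup>+x. set_norm (F x) \<partial>lebesgue)))"
    using vitali_const_pos[where ?'a="real^'n"]
    by (intro exI[of _ "2 * vitali_const TYPE(real^'n)"] conjI[OF _ allI[OF impI[OF maximal_op_weak_L1K]]]) simp
qed

end
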